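(* Let $G=(V,E)$ be a finite, simple, undirected graph with $|V|\ge 3$. If $G$ is a join graph, i.e. $G=G_1\otimes G_2$ for two vertex-disjoint graphs $G_1,G_2$, each with at least one vertex, then $G$ is antimagic.
   Context: All graphs are finite, simple and undirected. For vertex-disjoint graphs $G_1$ and $G_2$, the join $G_1\otimes G_2$ is the graph with vertex set $V(G_1)\cup V(G_2)$ whose edges are the edges of $G_1$, the edges of $G_2$, and all edges $uv$ with $u\in V(G_1)$ and $v\in V(G_2)$. The graphs $G_1$ and $G_2$ need not be connected. Given a graph $G=(V,E)$ with $m=|E|$ and a bijection $f:E\to\{1,2,\ldots,m\}$, the vertex-sum of $u\in V$ is $\sigma(u)=\sum_{v\in V:\,uv\in E} f(uv)$. The bijection $f$ is an antimagic labelling of $G$ if the values $\sigma(u)$, $u\in V$, are pairwise distinct. The graph $G$ is antimagic if it admits at least one antimagic labelling. *)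

theory Defs
  imports Main
begin

text \<open>A graph is a pair of a vertex set and an edge set; an undirected edge \<open>uv\<close> is the
  set \<open>{u, v}\<close>.\<close>

type_synonym 'a graph = "'a set \<times> 'a set set"

abbreviation verts :: "'a graph \<Rightarrow> 'a set"
  where "verts G \<equiv> fst G"

abbreviation edges :: "'a graph \<Rightarrow> 'a set set"
  where "edges G \<equiv> snd G"

definition finite_simple_graph :: "'a graph \<Rightarrow> bool"
  where "finite_simple_graph G \<longleftrightarrow>
    finite (verts G) \<and> (\<forall>e \<in> edges G. \<exists>u \<in> verts G. \<exists>v \<in> verts G. u \<noteq> v \<and> e = {u, v})"

text \<open>The join is meant for graphs with disjoint vertex sets; disjointness is required where
  the operation is used.\<close>

definition join :: "'a graph \<Rightarrow> 'a graph \<Rightarrow> 'a graph"  (infixr \<open>\<otimes>\<^sub>g\<close> 65)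
  where "G1 \<otimes>\<^sub>g G2 =
    (verts G1 \<union> verts G2,
     edges G1 \<union> edges G2 \<union> {{u, v} | u v. u \<in> verts G1 \<and> v \<in> verts G2})"

definition join_graph :: "'a graph \<Rightarrow> bool"
  where "join_graph G \<longleftrightarrow> (\<exists>G1 G2.
    finite_simple_graph G1 \<and> finite_simple_graph G2 \<and>
    verts G1 \<noteq> {} \<and> verts G2 \<noteq> {} \<and> verts G1 \<inter> verts G2 = {} \<and> G = G1 \<otimes>\<^sub>g G2)"

definition vertex_sum :: "'a graph \<Rightarrow> ('a set \<Rightarrow> nat) \<Rightarrow> 'a \<Rightarrow> nat"
  where "vertex_sum G f u = (\<Sum>v | v \<in> verts G \<and> {u, v} \<in> edges G. f {u, v})"

definition antimagic_labelling :: "'a graph \<Rightarrow> ('a set \<Rightarrow> nat) \<Rightarrow> bool"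
  where "antimagic_labelling G f \<longleftrightarrow>
    bij_betw f (edges G) {1..card (edges G)} \<and> inj_on (vertex_sum G f) (verts G)"

definition antimagic :: "'a graph \<Rightarrow> bool"
  where "antimagic G \<longleftrightarrow> (\<exists>f. antimagic_labelling G f)"

end

theory Submission
  imports Defs "HOL-Combinatorics.Transposition" "HOL-Library.FuncSet"
begin

text \<open>
  Let \<open>A\<close> and \<open>B\<close> be the vertex sets of the two sides. The edges inside the sides receive the
  smallest labels \<open>1, \<dots>, L\<close> in an arbitrary way, and all remaining freedom is in the labels
  \<open>L + 1, \<dots>, L + |A| |B|\<close> of the complete bipartite graph between \<open>A\<close> and \<open>B\<close>. Of the inside
  labelling only the partial sums \<open>p\<close> on \<open>A\<close> and \<open>q\<close> on \<open>B\<close> that it produces are remembered. The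
  question is then about numbers: find \<open>c\<close> such that all row sums \<open>p x + (\<Sum>y. c x y)\<close> and all
  column sums \<open>q y + (\<Sum>x. c x y)\<close> are distinct (\<open>separating\<close>).

  If both sides have at least three vertices, a greedy procedure works
  (\<open>ex_separating_greedy\<close>). Each vertex \<open>v\<close> has a price: the sum that it would end up with if its
  unlabelled edges got the smallest unused labels. Give these labels to the edges at a vertex \<open>v\<close>
  of least price and remove \<open>v\<close>. Every other vertex ends up with a strictly larger sum: vertices on
  the side of \<open>v\<close> start no lower and receive larger labels, and a vertex opposite to \<open>v\<close> cannot
  get all of the cheap labels on which its own price was based, because only one of its edges
  leads to \<open>v\<close> (\<open>separating_insert\<close>). So \<open>v\<close> can be forgotten, and the way in which its labels are
  distributed over its edges is still free.

  The procedure stops when the side of \<open>v\<close> is down to a single vertex \<open>u\<close>. What is left is a star at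
  \<open>u\<close>, whose labels have a fixed sum, so the leaves must get distinct sums that avoid the sum of
  \<open>u\<close>. The distribution of the labels at \<open>v\<close> and at \<open>u\<close> is free. If the partial sums of the leaves
  are already distinct, then distributing both sets of labels in increasing order almost works, and
  exchanging two labels repairs a collision with \<open>u\<close> (\<open>ex_two_rankings_avoiding\<close>). The partial
  sums of the leaves are distinct because an earlier removal on the side of \<open>v\<close> has distributed its
  labels increasingly; this is where three vertices on each side are used.

  Two families of joins remain. If some vertex is adjacent to all others, then it receives the largest
  labels and hence the largest sum (\<open>ex_separating_star\<close>). If \<open>|B| = 2\<close> and no vertex is adjacent to
  all others, then the vertices of \<open>B\<close> are not adjacent and every vertex of \<open>A\<close> misses a vertex of
  \<open>A\<close>. The sums of \<open>A\<close> are then small enough for an explicit labelling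
  (\<open>ex_separating_pair\<close>).
\<close>

section \<open>Rankings and sums of distinct numbers\<close>

lemma ex_ranking:
  fixes q :: "'a \<Rightarrow> nat"
  assumes "finite B"
  shows "\<exists>r. bij_betw r B {1..card B} \<and> (\<forall>x\<in>B. \<forall>y\<in>B. r x < r y \<longrightarrow> q x \<le> q y)"
  using assms
proof (induction rule: finite_ranking_induct[where f = q])
  case empty
  then show ?case by (auto simp: bij_betw_def)
next
  case (insert x S)
  show ?case
  proof (cases "x \<in> S")
    case True
    then show ?thesis using insert by (simp add: insert_absorb)
  next
    case False
    from insert obtain r where r: "bij_betw r S {1..card S}"
      and mono: "\<forall>x\<in>S. \<forall>y\<in>S. r x < r y \<longrightarrow> q x \<le> q y" by blast
    let ?r = "r(x := Suc (card S))"
    have "bij_betw ?r S {1..card S}"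
      using r False by (subst bij_betw_cong[where g = r]) auto
    then have "bij_betw ?r (insert x S) (insert (Suc (card S)) {1..card S})"
      using bij_betw_combine[of ?r S "{1..card S}" "{x}" "{Suc (card S)}"] by (simp add: bij_betw_def)
    moreover have "insert (Suc (card S)) {1..card S} = {1..card (insert x S)}"
      using insert False by auto
    moreover have "\<not> Suc (card S) < r y" if "y \<in> S" for y
      using bij_betwE[OF r] that by fastforce
    then have "\<forall>y\<in>insert x S. \<forall>z\<in>insert x S. ?r y < ?r z \<longrightarrow> q y \<le> q z"
      using mono insert.hyps False by auto
    ultimately show ?thesis by metis
  qed
qed

text \<open>Labels that are handed out in the order of the partial sums make all sums distinct, even when
  the partial sums are not.\<close>

lemma inj_on_add_ranking:
  fixes q r :: "'a \<Rightarrow> nat"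
  assumes "inj_on r B" and "\<forall>x\<in>B. \<forall>y\<in>B. r x < r y \<longrightarrow> q x \<le> q y" and "0 < m"
  shows "inj_on (\<lambda>y. q y + m * r y) B"
proof (rule inj_onI)
  fix x y assume xy: "x \<in> B" "y \<in> B" "q x + m * r x = q y + m * r y"
  have less: "q x + m * r x < q y + m * r y" if "x \<in> B" "y \<in> B" "r x < r y" for x y
    using assms that by (intro add_le_less_mono) auto
  have "r x = r y"
    using less[of x y] less[of y x] xy by (cases "r x" "r y" rule: linorder_cases) auto
  then show "x = y" using assms(1) xy by (auto simp: inj_on_def)
qed

lemma sum_distinct_ge:
  fixes f :: "'a \<Rightarrow> nat"
  assumes "finite X" "inj_on f X" "\<And>x. x \<in> X \<Longrightarrow> M < f x"
  shows "card X * M + \<Sum>{1..card X} \<le> sum f X"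
  using assms
proof (induction rule: finite_ranking_induct[where f = f])
  case empty
  then show ?case by simp
next
  case (insert x S)
  show ?case
  proof (cases "x \<in> S")
    case True
    then show ?thesis using insert by (simp add: insert_absorb)
  next
    case False
    have "f ` insert x S \<subseteq> {M<..f x}"
      using insert by fastforce
    then have "card (f ` insert x S) \<le> card {M<..f x}"
      by (intro card_mono) auto
    then have "Suc (card S) \<le> f x - M"
      using insert False by (simp add: card_image)
    then have "M + Suc (card S) \<le> f x" by simp
    then show ?thesis using insert False by simp
  qed
qed

section \<open>Separating labellings of a complete bipartite graph\<close>

text \<open>The pairs in \<open>A \<times> B\<close> stand for the edges of the complete bipartite graph, and \<open>p\<close>, \<open>q\<close> are the
  sums that the vertices have accumulated from edges with labels up to \<open>L\<close>. Keeping \<open>p\<close>, \<open>q\<close> and \<open>L\<close>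
  as parameters makes the notion stable under removing a vertex whose edges have been labelled.\<close>

definition separating ::
    "'a set \<Rightarrow> 'b set \<Rightarrow> ('a \<Rightarrow> nat) \<Rightarrow> ('b \<Rightarrow> nat) \<Rightarrow> nat \<Rightarrow> ('a \<Rightarrow> 'b \<Rightarrow> nat) \<Rightarrow> bool" where
  "separating A B p q L c \<longleftrightarrow>
    bij_betw (case_prod c) (A \<times> B) {L<..L + card A * card B} \<and>
    inj_on (\<lambda>x. p x + (\<Sum>y\<in>B. c x y)) A \<and>
    inj_on (\<lambda>y. q y + (\<Sum>x\<in>A. c x y)) B \<and>
    (\<forall>x\<in>A. \<forall>y\<in>B. p x + (\<Sum>y\<in>B. c x y) \<noteq> q y + (\<Sum>x\<in>A. c x y))"

lemma separating_swap:
  assumes "separating A B p q L c"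
  shows "separating B A q p L (\<lambda>y x. c x y)"
proof -
  have "bij_betw prod.swap (B \<times> A) (A \<times> B)"
    by (rule bij_betwI[where g = prod.swap]) auto
  moreover have "bij_betw (case_prod c) (A \<times> B) {L<..L + card A * card B}"
    using assms unfolding separating_def by blast
  ultimately have "bij_betw (case_prod c \<circ> prod.swap) (B \<times> A) {L<..L + card A * card B}"
    by (rule bij_betw_trans)
  then have "bij_betw (\<lambda>(y, x). c x y) (B \<times> A) {L<..L + card B * card A}"
    unfolding mult.commute[of "card A"]
    by (subst bij_betw_cong[where g = "case_prod c \<circ> prod.swap"]) auto
  then show ?thesis
    using assms unfolding separating_def by (intro conjI ballI) (simp_all, metis)
qed

text \<open>The last stage of the greedy procedure: a star with centre \<open>u\<close>. The sum of the centre is the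
  same for all distributions of the labels.\<close>

lemma separating_single:
  assumes "bij_betw b B {1..card B}"
    and "inj_on (\<lambda>y. q y + b y) B"
    and "\<And>y. y \<in> B \<Longrightarrow> q y + (L + b y) \<noteq> p u + (card B * L + \<Sum>{1..card B})"
  shows "separating {u} B p q L (\<lambda>_ y. L + b y)"
proof -
  have "bij_betw ((+) L) {1..card B} {L<..L + card B}"
    by (rule bij_betwI[where g = "\<lambda>n. n - L"]) auto
  with assms(1) have "bij_betw ((+) L \<circ> b) B {L<..L + card B}"
    by (rule bij_betw_trans)
  moreover have "bij_betw snd ({u} \<times> B) B"
    by (rule bij_betwI[where g = "Pair u"]) auto
  ultimately have "bij_betw ((+) L \<circ> b \<circ> snd) ({u} \<times> B) {L<..L + card B}"
    by (intro bij_betw_trans[of snd])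
  then have "bij_betw (\<lambda>(_, y). L + b y) ({u} \<times> B) {L<..L + card B}"
    by (subst bij_betw_cong[where g = "(+) L \<circ> b \<circ> snd"]) auto
  moreover have "(\<Sum>y\<in>B. L + b y) = card B * L + \<Sum>{1..card B}"
    using sum.reindex_bij_betw[OF assms(1), of "\<lambda>i. i"] by (simp add: sum.distrib)
  moreover have "inj_on (\<lambda>y. q y + (L + b y)) B"
    using assms(2) by (auto simp: inj_on_def)
  moreover have "\<forall>y\<in>B. p u + (card B * L + \<Sum>{1..card B}) \<noteq> q y + (L + b y)"
    using assms(3) by metis
  ultimately show ?thesis unfolding separating_def by simp
qed

text \<open>The greedy step. The assumptions say that \<open>v\<close> has the least price among all vertices, and the
  bijection \<open>r\<close> that distributes the labels at \<open>v\<close> is arbitrary. The final sum of \<open>v\<close> is its price.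
  For \<open>w\<close> opposite to \<open>v\<close>, write \<open>a\<close> for the size of \<open>A\<close> and \<open>k\<close> for that of \<open>B\<close>. The other \<open>a\<close>
  edges at \<open>w\<close> get distinct labels above \<open>L + k\<close>, so the sum of \<open>w\<close> exceeds its price by at
  least \<open>a k - a\<close>, which is positive for \<open>k \<ge> 2\<close>.\<close>

lemma separating_insert:
  fixes A :: "'a set" and B :: "'b set" and p :: "'a \<Rightarrow> nat" and q :: "'b \<Rightarrow> nat"
  assumes fin: "finite A" "finite B" and v: "v \<notin> A" and ne: "A \<noteq> {}" and k: "2 \<le> card B"
    and vmin: "\<And>u. u \<in> A \<Longrightarrow> p v \<le> p u"
    and vless: "\<And>w. w \<in> B \<Longrightarrow>
      p v + (card B * L + \<Sum>{1..card B}) \<le> q w + (Suc (card A) * L + \<Sum>{1..Suc (card A)})"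
    and r: "bij_betw r B {1..card B}"
    and sep: "separating A B p (\<lambda>w. q w + (L + r w)) (L + card B) c"
  shows "separating (insert v A) B p q L (c(v := \<lambda>w. L + r w))"
proof -
  let ?c = "c(v := \<lambda>w. L + r w)"
  let ?a = "card A" and ?k = "card B"
  have cA: "?c x = c x" if "x \<in> A" for x using that v by auto
  have rB: "1 \<le> r w" "r w \<le> ?k" if "w \<in> B" for w using bij_betwE[OF r] that by auto
  have bij: "bij_betw (case_prod c) (A \<times> B) {L + ?k<..L + ?k + ?a * ?k}"
    using sep unfolding separating_def by blast
  have clow: "L + ?k < c x w" if "x \<in> A" "w \<in> B" for x w
    using bij_betwE[OF bij] that by auto
  have rowv: "(\<Sum>w\<in>B. ?c v w) = ?k * L + \<Sum>{1..?k}"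
    using sum.reindex_bij_betw[OF r, of "\<lambda>i. i"] by (simp add: sum.distrib)
  have row: "(\<Sum>w\<in>B. ?c x w) = (\<Sum>w\<in>B. c x w)" if "x \<in> A" for x
    using cA[OF that] by simp
  have col: "q w + (\<Sum>x\<in>insert v A. ?c x w) = q w + (L + r w) + (\<Sum>x\<in>A. c x w)" for w
  proof -
    have "(\<Sum>x\<in>A. ?c x w) = (\<Sum>x\<in>A. c x w)" using cA by (intro sum.cong) auto
    then show ?thesis using fin v by simp
  qed
  have c_bij: "bij_betw (case_prod ?c) (insert v A \<times> B) {L<..L + card (insert v A) * ?k}"
  proof -
    have "bij_betw ((+) L) {1..?k} {L<..L + ?k}"
      by (rule bij_betwI[where g = "\<lambda>n. n - L"]) auto
    moreover have "bij_betw snd ({v} \<times> B) B"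
      by (rule bij_betwI[where g = "Pair v"]) auto
    ultimately have "bij_betw ((+) L \<circ> (r \<circ> snd)) ({v} \<times> B) {L<..L + ?k}"
      by (intro bij_betw_trans[OF bij_betw_trans[OF _ r]])
    then have "bij_betw (case_prod ?c) ({v} \<times> B) {L<..L + ?k}"
      by (subst bij_betw_cong[where g = "(+) L \<circ> (r \<circ> snd)"]) auto
    moreover have "bij_betw (case_prod ?c) (A \<times> B) {L + ?k<..L + ?k + ?a * ?k}"
      using bij by (subst bij_betw_cong[where g = "case_prod c"]) (use v in auto)
    ultimately have "bij_betw (case_prod ?c) ({v} \<times> B \<union> A \<times> B)
        ({L<..L + ?k} \<union> {L + ?k<..L + ?k + ?a * ?k})"
      by (rule bij_betw_combine) auto
    moreover have "{v} \<times> B \<union> A \<times> B = insert v A \<times> B" by auto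
    moreover have "{L<..L + ?k} \<union> {L + ?k<..L + ?k + ?a * ?k} = {L<..L + card (insert v A) * ?k}"
      using fin v by auto
    ultimately show ?thesis by simp
  qed
  have v_row: "p v + (\<Sum>w\<in>B. ?c v w) < p u + (\<Sum>w\<in>B. ?c u w)" if u: "u \<in> A" for u
  proof -
    have "(\<Sum>w\<in>B. ?c v w) < (\<Sum>w\<in>B. ?c u w)"
    proof (rule sum_strict_mono)
      show "B \<noteq> {}" using k by auto
      show "?c v w < ?c u w" if "w \<in> B" for w
        using clow[OF u that] rB[OF that] cA[OF u] by auto
    qed (use fin in auto)
    then show ?thesis using vmin[OF u] by simp
  qed
  have v_col: "p v + (\<Sum>w\<in>B. ?c v w) < q w + (\<Sum>x\<in>insert v A. ?c x w)" if w: "w \<in> B" for w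
  proof -
    have "inj_on (\<lambda>x. c x w) A"
      using bij w unfolding bij_betw_def inj_on_def by fastforce
    then have "?a * (L + ?k) + \<Sum>{1..?a} \<le> (\<Sum>x\<in>A. c x w)"
      using fin clow w by (intro sum_distinct_ge) auto
    moreover have "?a * 2 \<le> ?a * ?k" using k by simp
    moreover have sum_Suc: "\<Sum>{1..Suc ?a} = \<Sum>{1..?a} + Suc ?a" by simp
    moreover have "1 \<le> ?a" using ne fin by (simp add: Suc_leI card_gt_0_iff)
    ultimately show ?thesis
      using vless[OF w] rB[OF w] unfolding rowv col distrib_left sum_Suc mult_Suc by linarith
  qed
  have row_inj: "inj_on (\<lambda>x. p x + (\<Sum>w\<in>B. ?c x w)) (insert v A)"
  proof -
    have "inj_on (\<lambda>x. p x + (\<Sum>w\<in>B. ?c x w)) A"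
      using sep row unfolding separating_def by (simp add: inj_on_def)
    moreover have "p v + (\<Sum>w\<in>B. ?c v w) \<notin> (\<lambda>x. p x + (\<Sum>w\<in>B. ?c x w)) ` A"
      using v_row by (auto dest: less_imp_neq)
    ultimately show ?thesis using v by simp
  qed
  have col_inj: "inj_on (\<lambda>w. q w + (\<Sum>x\<in>insert v A. ?c x w)) B"
    using sep unfolding col separating_def by blast
  have row_col: "p x + (\<Sum>w\<in>B. ?c x w) \<noteq> q w + (\<Sum>x\<in>insert v A. ?c x w)"
    if "x \<in> insert v A" "w \<in> B" for x w
  proof (cases "x = v")
    case True
    then show ?thesis using v_col[OF that(2)] by simp
  next
    case False
    then have "x \<in> A" using that by simp
    then show ?thesis
      using sep that(2) unfolding col row[OF \<open>x \<in> A\<close>] separating_def by blast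
  qed
  show ?thesis
    unfolding separating_def using c_bij row_inj col_inj row_col by (intro conjI ballI)
qed

text \<open>With \<open>r\<close> the ranking by \<open>q\<close>, the choice \<open>s = r\<close> makes the sums increase in steps of at least 3.
  If one of them, at \<open>x\<close>, equals \<open>t\<close>, exchange in \<open>s\<close> the values at \<open>x\<close> and at a neighbour of
  \<open>x\<close> in the ranking. This moves both sums by 1, in opposite directions, so that the order is kept
  and \<open>t\<close> is missed.\<close>

lemma ex_two_rankings_avoiding:
  fixes q :: "'b \<Rightarrow> nat"
  assumes fin: "finite B" and k: "2 \<le> card B" and inj: "inj_on q B"
  shows "\<exists>r s. bij_betw r B {1..card B} \<and> bij_betw s B {1..card B} \<and>
    inj_on (\<lambda>y. q y + r y + s y) B \<and> (\<forall>y\<in>B. q y + r y + s y \<noteq> t)"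
proof -
  obtain r where r: "bij_betw r B {1..card B}"
    and mono: "\<forall>x\<in>B. \<forall>y\<in>B. r x < r y \<longrightarrow> q x \<le> q y"
    using ex_ranking[OF fin] by blast
  have rinj: "r x = r y \<longleftrightarrow> x = y" if "x \<in> B" "y \<in> B" for x y
    using r that by (auto simp: bij_betw_def inj_on_def)
  have smono: "q x < q y" if "x \<in> B" "y \<in> B" "r x < r y" for x y
    using mono inj that by (metis inj_onD le_neq_implies_less less_irrefl)
  have injI: "inj_on h B" if "\<And>x y. x \<in> B \<Longrightarrow> y \<in> B \<Longrightarrow> r x < r y \<Longrightarrow> h x < h y" for h :: "'b \<Rightarrow> nat"
  proof (rule inj_onI)
    fix x y assume xy: "x \<in> B" "y \<in> B" "h x = h y"
    then have "\<not> r x < r y" "\<not> r y < r x"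
      using that[of x y] that[of y x] by auto
    then show "x = y" using rinj xy by simp
  qed
  have rr: "inj_on (\<lambda>y. q y + r y + r y) B"
    using smono by (intro injI) fastforce
  show ?thesis
  proof (cases "\<exists>x\<in>B. q x + r x + r x = t")
    case False
    then show ?thesis using r rr by blast
  next
    case True
    then obtain x where x: "x \<in> B" "q x + r x + r x = t" by blast
    have "\<exists>i\<in>{1..card B}. i = Suc (r x) \<or> r x = Suc i"
    proof (cases "r x = card B")
      case True
      then show ?thesis using k by (intro bexI[of _ "card B - 1"]) auto
    next
      case False
      then show ?thesis using bij_betwE[OF r] x by (intro bexI[of _ "Suc (r x)"]) force+
    qed
    then obtain y where y: "y \<in> B" "r y = Suc (r x) \<or> r x = Suc (r y)"
      unfolding bij_betw_imp_surj_on[OF r, symmetric] by blast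
    let ?s = "r \<circ> transpose x y"
    have s: "bij_betw ?s B {1..card B}"
    proof (rule bij_betw_trans[OF _ r])
      show "bij_betw (transpose x y) B B"
        using x(1) y(1) by simp
    qed
    have s_eq: "?s z = (if z = x then r y else if z = y then r x else r z)" for z
      by (simp add: transpose_def)
    have "q z + r z + ?s z < q z' + r z' + ?s z'" if z: "z \<in> B" "z' \<in> B" "r z < r z'" for z z'
    proof -
      have "r z + ?s z \<le> r z' + ?s z'"
        using z x y rinj[OF z(1) x(1)] rinj[OF z(1) y(1)] rinj[OF z(2) x(1)] rinj[OF z(2) y(1)]
        unfolding s_eq by (auto split: if_splits)
      then show ?thesis using smono[OF z] by simp
    qed
    then have "inj_on (\<lambda>z. q z + r z + ?s z) B" by (rule injI)
    moreover have "q z + r z + ?s z \<noteq> t" if z: "z \<in> B" for z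
    proof (cases "z = x \<or> z = y")
      case True
      then show ?thesis
        using x y smono[OF x(1) y(1)] smono[OF y(1) x(1)] unfolding s_eq by auto
    next
      case False
      then show ?thesis
        using inj_onD[OF rr _ z x(1)] x(2) unfolding s_eq by auto
    qed
    ultimately show ?thesis using r s by blast
  qed
qed

text \<open>The disjunctions are the invariant of the procedure. While \<open>A\<close> has at least three elements,
  removing one of them leaves \<open>q\<close> injective on \<open>B\<close>; once only two are left, \<open>q\<close> must be injective
  already, since removing one of them ends the procedure.\<close>

lemma ex_separating_greedy:
  fixes A B :: "'a set"
  assumes "finite A" "finite B" "2 \<le> card A" "2 \<le> card B"
    and "3 \<le> card A \<or> inj_on q B" "3 \<le> card B \<or> inj_on p A"
  shows "\<exists>c. separating A B p q L c"
  using assms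
proof (induction "card A + card B" arbitrary: A B p q L rule: less_induct)
  case less
  \<comment> \<open>Stated for arbitrary sides so that it serves for a least price on either side.\<close>
  have A_step: "\<exists>c. separating A B p q L c"
    if hyp: "finite A" "finite B" "2 \<le> card A" "2 \<le> card B"
      "3 \<le> card A \<or> inj_on q B" "3 \<le> card B \<or> inj_on p A"
      and v: "v \<in> A" "\<And>u. u \<in> A \<Longrightarrow> p v \<le> p u"
      and vless: "\<And>w. w \<in> B \<Longrightarrow>
        p v + (card B * L + \<Sum>{1..card B}) \<le> q w + (card A * L + \<Sum>{1..card A})"
      and IH: "\<And>p' q' L'. 2 \<le> card (A - {v}) \<Longrightarrow> 3 \<le> card (A - {v}) \<or> inj_on q' B \<Longrightarrow>
        3 \<le> card B \<or> inj_on p' (A - {v}) \<Longrightarrow> \<exists>c. separating (A - {v}) B p' q' L' c"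
    for A B :: "'a set" and p q :: "'a \<Rightarrow> nat" and v
  proof -
    let ?A = "A - {v}"
    have card_A: "card A = Suc (card ?A)"
      using card_Suc_Diff1[OF hyp(1) v(1)] by simp
    have ins: "\<exists>c. separating A B p q L c"
      if "bij_betw r B {1..card B}"
        and "separating ?A B p (\<lambda>w. q w + (L + r w)) (L + card B) c" for r c
    proof -
      have "separating (insert v ?A) B p q L (c(v := \<lambda>w. L + r w))"
      proof (rule separating_insert[OF _ hyp(2) _ _ hyp(4) _ _ that])
        show "?A \<noteq> {}" using card_A hyp(3) by (metis One_nat_def Suc_1 Suc_n_not_le_n card.empty)
        show "p v + (card B * L + \<Sum>{1..card B}) \<le> q w + (Suc (card ?A) * L + \<Sum>{1..Suc (card ?A)})"
          if "w \<in> B" for w using vless[OF that] unfolding card_A .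
      qed (use hyp(1) v(2) in auto)
      then show ?thesis using v by (auto simp: insert_absorb)
    qed
    show ?thesis
    proof (cases "card A = 2")
      case True
      then have "card ?A = 1" using card_A by linarith
      then obtain u where u: "?A = {u}" by (rule card_1_singletonE)
      \<comment> \<open>The labels up to \<open>M\<close> are spent on \<open>v\<close>; those of the star at \<open>u\<close> follow.\<close>
      define M where "M = L + card B"
      have "inj_on q B" using hyp True by simp
      then obtain r s where r: "bij_betw r B {1..card B}" and s: "bij_betw s B {1..card B}"
        and inj: "inj_on (\<lambda>y. q y + r y + s y) B"
        \<comment> \<open>The truncated subtraction is harmless: a collision would give the minuend at least \<open>L + M\<close>.\<close>
        and avoid: "\<forall>y\<in>B. q y + r y + s y \<noteq>
          p u + (card B * M + \<Sum>{1..card B}) - (L + M)"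
        using ex_two_rankings_avoiding[OF hyp(2,4)] by blast
      have "separating {u} B p (\<lambda>w. q w + (L + r w)) M (\<lambda>_ w. M + s w)"
      proof (rule separating_single[OF s])
        show "inj_on (\<lambda>y. q y + (L + r y) + s y) B"
          using inj unfolding inj_on_def by simp
        show "q y + (L + r y) + (M + s y) \<noteq> p u + (card B * M + \<Sum>{1..card B})"
          if "y \<in> B" for y using avoid that by fastforce
      qed
      then show ?thesis using ins[OF r] u unfolding M_def by metis
    next
      case False
      obtain r where r: "bij_betw r B {1..card B}"
        and mono: "\<forall>x\<in>B. \<forall>y\<in>B. r x < r y \<longrightarrow> q x \<le> q y"
        using ex_ranking[OF hyp(2)] by blast
      have "inj_on (\<lambda>w. q w + 1 * r w) B"
        by (rule inj_on_add_ranking[OF bij_betw_imp_inj_on[OF r] mono]) simp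
      then have "inj_on (\<lambda>w. q w + (L + r w)) B" by (simp add: inj_on_def)
      moreover have "2 \<le> card ?A" using False hyp card_A by simp
      moreover have "3 \<le> card B \<or> inj_on p ?A" using hyp by (auto intro: inj_on_subset)
      ultimately obtain c where "separating ?A B p (\<lambda>w. q w + (L + r w)) (L + card B) c"
        using IH by blast
      then show ?thesis using ins[OF r] by blast
    qed
  qed
  have "A \<noteq> {}" "B \<noteq> {}" using less.prems by auto
  define v where "v = arg_min_on p A"
  define w where "w = arg_min_on q B"
  have v: "v \<in> A" "\<And>u. u \<in> A \<Longrightarrow> p v \<le> p u"
    unfolding v_def using less.prems \<open>A \<noteq> {}\<close> by (auto intro: arg_min_if_finite arg_min_least)
  have w: "w \<in> B" "\<And>u. u \<in> B \<Longrightarrow> q w \<le> q u"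
    unfolding w_def using less.prems \<open>B \<noteq> {}\<close> by (auto intro: arg_min_if_finite arg_min_least)
  show ?case
  proof (cases "p v + (card B * L + \<Sum>{1..card B}) \<le> q w + (card A * L + \<Sum>{1..card A})")
    case True
    show ?thesis
    proof (rule A_step[OF less.prems v])
      show "p v + (card B * L + \<Sum>{1..card B}) \<le> q y + (card A * L + \<Sum>{1..card A})"
        if "y \<in> B" for y using True w(2)[OF that] by linarith
      show "\<exists>c. separating (A - {v}) B p' q' L' c"
        if "2 \<le> card (A - {v})" "3 \<le> card (A - {v}) \<or> inj_on q' B"
          "3 \<le> card B \<or> inj_on p' (A - {v})" for p' q' L'
        using that less.prems v(1) by (intro less.hyps) (auto simp: card_gt_0_iff)
    qed
  next
    case False
    have "\<exists>c. separating B A q p L c"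
    proof (rule A_step[OF less.prems(2,1,4,3,6,5) w])
      show "q w + (card A * L + \<Sum>{1..card A}) \<le> p y + (card B * L + \<Sum>{1..card B})"
        if "y \<in> A" for y using False v(2)[OF that] by linarith
      show "\<exists>c. separating (B - {w}) A p' q' L' c"
        if "2 \<le> card (B - {w})" "3 \<le> card (B - {w}) \<or> inj_on q' A"
          "3 \<le> card A \<or> inj_on p' (B - {w})" for p' q' L'
      proof -
        have "\<exists>c. separating A (B - {w}) q' p' L' c"
          using that less.prems w(1) by (intro less.hyps) (auto simp: card_gt_0_iff)
        then show ?thesis by (blast dest: separating_swap)
      qed
    qed
    then show ?thesis by (blast dest: separating_swap)
  qed
qed

text \<open>The vertex \<open>w\<close> wins: a vertex in \<open>A\<close> has at most \<open>card A - 1\<close> small labels and a single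
  large one.\<close>

lemma ex_separating_star:
  assumes fin: "finite A" and a: "2 \<le> card A"
    and p: "\<And>u. u \<in> A \<Longrightarrow> p u \<le> (card A - 1) * L" and q: "q w = 0"
  shows "\<exists>c. separating A {w} p q L c"
proof -
  obtain r where r: "bij_betw r A {1..card A}"
    and mono: "\<forall>x\<in>A. \<forall>y\<in>A. r x < r y \<longrightarrow> p x \<le> p y"
    using ex_ranking[OF fin] by blast
  have inj: "inj_on (\<lambda>u. p u + 1 * r u) A"
    by (rule inj_on_add_ranking[OF bij_betw_imp_inj_on[OF r] mono]) simp
  obtain n where n: "card A = Suc n" "1 \<le> n" using a by (cases "card A") auto
  then have "{1..n} \<noteq> {}" "n \<in> {1..n}" by auto
  then have "n \<le> \<Sum>{1..n}" by (intro member_le_sum) auto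
  have "separating {w} A q p L (\<lambda>_ u. L + r u)"
  proof (rule separating_single[OF r])
    show "inj_on (\<lambda>u. p u + r u) A" using inj by simp
    show "p u + (L + r u) \<noteq> q w + (card A * L + \<Sum>{1..card A})" if u: "u \<in> A" for u
    proof -
      have "r u \<le> Suc n" using bij_betwE[OF r] u n by auto
      moreover have "p u \<le> n * L" using p[OF u] n by simp
      moreover have "\<Sum>{1..Suc n} = \<Sum>{1..n} + Suc n" by simp
      ultimately show ?thesis using \<open>n \<le> \<Sum>{1..n}\<close> n unfolding q n(1) mult_Suc by linarith
    qed
  qed
  then show ?thesis by (blast dest: separating_swap)
qed

text \<open>The vertex of rank \<open>i\<close> gets the labels \<open>L + 2i - 1\<close> (towards \<open>w\<close>) and \<open>L + 2i\<close> (towards \<open>w'\<close>).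
  For \<open>n = card A\<close>, its sum is at most \<open>n L + 4 n - 1\<close>, while \<open>w\<close> and \<open>w'\<close> get
  \<open>n L + n\<^sup>2\<close> and \<open>n L + n\<^sup>2 + n\<close>. For \<open>n \<ge> 4\<close> the latter are larger. For \<open>n = 2\<close> the sums on \<open>A\<close>
  are odd and the others are even. For \<open>n = 3\<close> the values interleave and have to be compared one by
  one, which succeeds for \<open>L \<le> 1\<close>.\<close>

lemma ex_separating_pair:
  assumes fin: "finite A" and a: "2 \<le> card A"
    and p: "\<And>u. u \<in> A \<Longrightarrow> p u \<le> (card A - 2) * L" and L: "card A = 3 \<Longrightarrow> L \<le> 1"
    and w: "w \<noteq> w'" and q: "q w = 0" "q w' = 0"
  shows "\<exists>c. separating A {w, w'} p q L c"
proof -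
  define n where "n = card A"
  obtain r where r: "bij_betw r A {1..card A}"
    and mono: "\<forall>x\<in>A. \<forall>y\<in>A. r x < r y \<longrightarrow> p x \<le> p y"
    using ex_ranking[OF fin] by blast
  have rA: "1 \<le> r u" "r u \<le> n" if "u \<in> A" for u
    using bij_betwE[OF r] that unfolding n_def by auto
  define c where "c u y = L + (2 * r u - (if y = w then 1 else 0))" for u y
  have bij: "bij_betw (case_prod c) (A \<times> {w, w'}) {L<..L + card A * card {w, w'}}"
  proof -
    have inj: "inj_on (case_prod c) (A \<times> {w, w'})"
    proof (rule inj_onI, clarify)
      fix u y u' y'
      assume *: "u \<in> A" "u' \<in> A" "y \<in> {w, w'}" "y' \<in> {w, w'}" "c u y = c u' y'"
      then have "r u = r u' \<and> (y = w \<longleftrightarrow> y' = w)"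
        using rA[of u] rA[of u'] unfolding c_def by (auto split: if_splits) presburger+
      then show "u = u' \<and> y = y'"
        using * bij_betw_imp_inj_on[OF r] by (auto simp: inj_on_def)
    qed
    have "case_prod c ` (A \<times> {w, w'}) = {L<..L + card A * card {w, w'}}"
    proof (rule card_subset_eq)
      show "case_prod c ` (A \<times> {w, w'}) \<subseteq> {L<..L + card A * card {w, w'}}"
        using rA w unfolding c_def n_def by fastforce
    qed (use inj in \<open>simp_all add: card_image card_cartesian_product\<close>)
    then show ?thesis using inj by (simp add: bij_betw_def)
  qed
  have row: "(\<Sum>y\<in>{w, w'}. c u y) + 1 = 2 * L + 4 * r u" if "u \<in> A" for u
    using w rA[OF that] by (simp add: c_def)
  have "(\<Sum>u\<in>A. 2 * r u) = (\<Sum>i\<in>{1..n}. 2 * i)"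
    unfolding n_def by (rule sum.reindex_bij_betw[OF r])
  also have "\<dots> = n * n + n" by (induction n) auto
  finally have double: "(\<Sum>u\<in>A. 2 * r u) = n * n + n" .
  have col': "(\<Sum>u\<in>A. c u w') = n * L + (n * n + n)"
    unfolding double[symmetric] using w by (simp add: c_def sum.distrib n_def)
  have "(\<Sum>u\<in>A. c u w) + n = (\<Sum>u\<in>A. c u w + 1)" unfolding sum.distrib by (simp add: n_def)
  also have "\<dots> = (\<Sum>u\<in>A. c u w')"
  proof (rule sum.cong)
    show "c u w + 1 = c u w'" if "u \<in> A" for u
      using rA[OF that] w by (simp add: c_def)
  qed simp
  finally have col: "(\<Sum>u\<in>A. c u w) = n * L + n * n" using col' by simp
  have inj: "inj_on (\<lambda>u. p u + (\<Sum>y\<in>{w, w'}. c u y)) A"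
  proof (rule inj_onI)
    fix u v assume uv: "u \<in> A" "v \<in> A"
      and eq: "p u + (\<Sum>y\<in>{w, w'}. c u y) = p v + (\<Sum>y\<in>{w, w'}. c v y)"
    have "inj_on (\<lambda>u. p u + 4 * r u) A"
      by (rule inj_on_add_ranking[OF bij_betw_imp_inj_on[OF r] mono]) simp
    moreover have "p u + 4 * r u = p v + 4 * r v"
      using eq row[OF uv(1)] row[OF uv(2)] by linarith
    ultimately show "u = v" using uv by (rule inj_onD)
  qed
  have "p u + (\<Sum>y\<in>{w, w'}. c u y) \<noteq> n * L + n * n \<and>
      p u + (\<Sum>y\<in>{w, w'}. c u y) \<noteq> n * L + (n * n + n)" if u: "u \<in> A" for u
  proof -
    have pu: "p u \<le> (n - 2) * L" using p[OF u] n_def by simp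
    consider "n = 2" | "n = 3" | "4 \<le> n" using a n_def by linarith
    then show ?thesis
    proof cases
      case 1
      then show ?thesis using pu row[OF u] by simp presburger
    next
      case 2
      then have "L \<le> 1" using L n_def by simp
      then show ?thesis using 2 pu row[OF u] by simp presburger
    next
      case 3
      obtain m where m: "n = m + 2" using 3 by (metis le_add_diff_inverse2 add_leD2 numeral_Bit0)
      have "(n - 2) * L + 2 * L = n * L" unfolding m by (simp add: add_mult_distrib)
      moreover have "4 * r u \<le> n * n" using rA[OF u] 3 by (intro mult_le_mono)
      ultimately show ?thesis using pu row[OF u] by linarith
    qed
  qed
  then have "\<forall>u\<in>A. \<forall>y\<in>{w, w'}. p u + (\<Sum>y\<in>{w, w'}. c u y) \<noteq> q y + (\<Sum>u\<in>A. c u y)"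
    using q col col' by auto
  moreover have "inj_on (\<lambda>y. q y + (\<Sum>u\<in>A. c u y)) {w, w'}"
    using q col col' a unfolding n_def by auto
  ultimately have "separating A {w, w'} p q L c"
    unfolding separating_def using bij inj by (intro conjI)
  then show ?thesis by blast
qed

section \<open>Labelling the edges of a join\<close>

definition dominating :: "'a graph \<Rightarrow> 'a \<Rightarrow> bool" where
  "dominating G x \<longleftrightarrow> x \<in> verts G \<and> (\<forall>v\<in>verts G. v \<noteq> x \<longrightarrow> {x, v} \<in> edges G)"

lemma join_commute:
  fixes G1 G2 :: "'a graph"
  shows "G1 \<otimes>\<^sub>g G2 = G2 \<otimes>\<^sub>g G1"
proof -
  have "{{u, v} |u v. u \<in> A \<and> v \<in> B} \<subseteq> {{u, v} |u v. u \<in> B \<and> v \<in> A}" for A B :: "'a set"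
  proof clarify
    fix u v assume "u \<in> A" "v \<in> B"
    then show "\<exists>u' v'. {u, v} = {u', v'} \<and> u' \<in> B \<and> v' \<in> A"
      by (intro exI[of _ v] exI[of _ u]) auto
  qed
  then have "{{u, v} |u v. u \<in> verts G1 \<and> v \<in> verts G2} = {{u, v} |u v. u \<in> verts G2 \<and> v \<in> verts G1}"
    by (intro subset_antisym)
  then show ?thesis unfolding join_def by (metis Un_commute)
qed

lemma edgeE:
  assumes "finite_simple_graph G" "e \<in> edges G"
  obtains x y where "x \<in> verts G" "y \<in> verts G" "x \<noteq> y" "e = {x, y}"
proof -
  have "\<forall>e\<in>edges G. \<exists>x\<in>verts G. \<exists>y\<in>verts G. x \<noteq> y \<and> e = {x, y}"
    using assms(1) unfolding finite_simple_graph_def by (rule conjunct2)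
  from bspec[OF this assms(2)] show ?thesis by (elim bexE conjE) (rule that)
qed

lemma edge_endpoints:
  assumes "finite_simple_graph G" "{u, v} \<in> edges G"
  shows "u \<in> verts G" "v \<in> verts G" "u \<noteq> v"
proof -
  obtain x y where xy: "x \<in> verts G" "y \<in> verts G" "x \<noteq> y" "{u, v} = {x, y}"
    using assms by (rule edgeE)
  from xy(4) have "u = x \<and> v = y \<or> u = y \<and> v = x" unfolding doubleton_eq_iff .
  then show "u \<in> verts G" "v \<in> verts G" "u \<noteq> v" using xy(1-3) by metis+
qed

lemma edge_subset: "finite_simple_graph G \<Longrightarrow> e \<in> edges G \<Longrightarrow> e \<subseteq> verts G"
  by (erule edgeE) auto

lemma finite_edges:
  assumes "finite_simple_graph G"
  shows "finite (edges G)"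
proof (rule finite_subset)
  show "edges G \<subseteq> Pow (verts G)" using edge_subset[OF assms] by blast
  show "finite (Pow (verts G))" using assms by (simp add: finite_simple_graph_def)
qed

text \<open>The set \<open>N\<close> need only contain the neighbours of \<open>u\<close>, so that a count of non-neighbours
  suffices to bound the sum.\<close>

lemma vertex_sum_le:
  assumes "finite N" and "{v. v \<in> verts G \<and> {u, v} \<in> edges G} \<subseteq> N"
    and "\<And>e. e \<in> edges G \<Longrightarrow> f e \<le> L"
  shows "vertex_sum G f u \<le> card N * L"
proof -
  have "vertex_sum G f u \<le> of_nat (card {v. v \<in> verts G \<and> {u, v} \<in> edges G}) * L"
    unfolding vertex_sum_def by (rule sum_bounded_above) (use assms in auto)
  also have "\<dots> \<le> card N * L"
    using assms by (simp add: card_mono)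
  finally show ?thesis .
qed

text \<open>A separating labelling of the pairs, together with any labelling of the edges inside the two
  sides by \<open>1, \<dots>, L\<close>, is an antimagic labelling of the join.\<close>

lemma antimagic_join_if_separating:
  fixes G1 G2 :: "'a graph"
  assumes G1: "finite_simple_graph G1" and G2: "finite_simple_graph G2"
    and disj: "verts G1 \<inter> verts G2 = {}"
    and f0: "bij_betw f0 (edges G1 \<union> edges G2) {1..L}"
    and sep: "separating (verts G1) (verts G2) (vertex_sum G1 f0) (vertex_sum G2 f0) L c"
  shows "antimagic (G1 \<otimes>\<^sub>g G2)"
proof -
  let ?A = "verts G1" and ?B = "verts G2" and ?E0 = "edges G1 \<union> edges G2" and ?G = "G1 \<otimes>\<^sub>g G2"
  define K where "K = {{u, v} |u v. u \<in> ?A \<and> v \<in> ?B}"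
  \<comment> \<open>An edge between the sides meets each side in one vertex, which recovers the arguments of \<open>c\<close>.\<close>
  define f where "f e = (if e \<in> ?E0 then f0 e else c (the_elem (e \<inter> ?A)) (the_elem (e \<inter> ?B)))" for e
  have fin: "finite ?A" "finite ?B" using G1 G2 by (auto simp: finite_simple_graph_def)
  have cross: "{u, v} \<notin> ?E0" if "u \<in> ?A" "v \<in> ?B" for u v
    using that disj edge_subset[OF G1, of "{u, v}"] edge_subset[OF G2, of "{u, v}"] by blast
  have f_cross: "f {u, v} = c u v" "f {v, u} = c u v" if "u \<in> ?A" "v \<in> ?B" for u v
  proof -
    have "{u, v} \<inter> ?A = {u}" "{u, v} \<inter> ?B = {v}" using that disj by auto
    then show "f {u, v} = c u v" using cross[OF that] by (simp add: f_def)
    then show "f {v, u} = c u v" by (simp add: insert_commute)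
  qed
  have "bij_betw f (?E0 \<union> K) ({1..L} \<union> {L<..L + card ?A * card ?B})"
  proof (rule bij_betw_combine)
    show "bij_betw f ?E0 {1..L}"
      using f0 by (subst bij_betw_cong[where g = f0]) (auto simp: f_def)
    have "bij_betw (\<lambda>(u, v). {u, v}) (?A \<times> ?B) K"
      using disj unfolding K_def bij_betw_def inj_on_def by (auto simp: doubleton_eq_iff image_def)
    moreover have "bij_betw (f \<circ> (\<lambda>(u, v). {u, v})) (?A \<times> ?B) {L<..L + card ?A * card ?B}"
      using sep unfolding separating_def
      by (subst bij_betw_cong[where g = "case_prod c"]) (auto simp: f_cross)
    ultimately show "bij_betw f K {L<..L + card ?A * card ?B}"
      using bij_betw_comp_iff by blast
  qed auto
  moreover have "?E0 \<union> K = edges ?G" by (simp add: join_def K_def)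
  moreover have "{1..L} \<union> {L<..L + card ?A * card ?B} = {1..L + card ?A * card ?B}" by auto
  ultimately have f: "bij_betw f (edges ?G) {1..L + card ?A * card ?B}" by simp
  then have bij: "bij_betw f (edges ?G) {1..card (edges ?G)}"
    using bij_betw_same_card[OF f] by simp
  have sum1: "vertex_sum ?G f u = vertex_sum G1 f0 u + (\<Sum>v\<in>?B. c u v)" if u: "u \<in> ?A" for u
  proof -
    have nbrs: "{v. v \<in> verts ?G \<and> {u, v} \<in> edges ?G} = {v. v \<in> ?A \<and> {u, v} \<in> edges G1} \<union> ?B"
      using u disj edge_endpoints[OF G1, of u] edge_endpoints[OF G2, of u]
      by (auto simp: join_def doubleton_eq_iff)
    have "vertex_sum ?G f u = (\<Sum>v | v \<in> ?A \<and> {u, v} \<in> edges G1. f {u, v}) + (\<Sum>v\<in>?B. f {u, v})"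
      unfolding vertex_sum_def nbrs using fin disj by (intro sum.union_disjoint) auto
    then show ?thesis
      using f_cross u by (simp add: vertex_sum_def f_def)
  qed
  have sum2: "vertex_sum ?G f v = vertex_sum G2 f0 v + (\<Sum>u\<in>?A. c u v)" if v: "v \<in> ?B" for v
  proof -
    have nbrs: "{u. u \<in> verts ?G \<and> {v, u} \<in> edges ?G} = {u. u \<in> ?B \<and> {v, u} \<in> edges G2} \<union> ?A"
      using v disj edge_endpoints[OF G1, of v] edge_endpoints[OF G2, of v]
      by (auto simp: join_def doubleton_eq_iff)
    have "vertex_sum ?G f v = (\<Sum>u | u \<in> ?B \<and> {v, u} \<in> edges G2. f {v, u}) + (\<Sum>u\<in>?A. f {v, u})"
      unfolding vertex_sum_def nbrs using fin disj by (intro sum.union_disjoint) auto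
    then show ?thesis
      using f_cross v by (simp add: vertex_sum_def f_def)
  qed
  have "inj_on (vertex_sum ?G f) (?A \<union> ?B)"
  proof -
    have "inj_on (vertex_sum ?G f) ?A" "inj_on (vertex_sum ?G f) ?B"
      using sep sum1 sum2 unfolding separating_def by (auto simp: inj_on_def)
    moreover have "vertex_sum ?G f u \<noteq> vertex_sum ?G f v" if "u \<in> ?A" "v \<in> ?B" for u v
      using sep that unfolding separating_def sum1[OF that(1)] sum2[OF that(2)] by blast
    ultimately show ?thesis unfolding inj_on_def by (metis Un_iff)
  qed
  with bij have "antimagic_labelling ?G f"
    by (simp add: antimagic_labelling_def join_def)
  then show ?thesis unfolding antimagic_def by blast
qed

lemma ex_inner_labelling:
  assumes "finite_simple_graph G1" "finite_simple_graph G2"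
  shows "\<exists>f0. bij_betw f0 (edges G1 \<union> edges G2) {1..card (edges G1 \<union> edges G2)}"
  using assms by (intro finite_same_card_bij) (auto simp: finite_edges)

text \<open>Such a graph is the join of the graph without \<open>x\<close> and the one-vertex graph
  on \<open>x\<close>.\<close>

lemma antimagic_if_dominating:
  assumes G: "finite_simple_graph G" and n: "3 \<le> card (verts G)" and x: "dominating G x"
  shows "antimagic G"
proof -
  let ?A = "verts G - {x}"
  define H where "H = (?A, {e \<in> edges G. x \<notin> e})"
  define P :: "'a graph" where "P = ({x}, {})"
  have H: "finite_simple_graph H" and P: "finite_simple_graph P"
  proof -
    have "\<exists>u\<in>?A. \<exists>v\<in>?A. u \<noteq> v \<and> e = {u, v}" if e: "e \<in> edges G" "x \<notin> e" for e
      using edgeE[OF G e(1)] e(2) by (metis DiffI insertCI singletonD)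
    then show "finite_simple_graph H"
      using G unfolding H_def finite_simple_graph_def by simp
    show "finite_simple_graph P" by (simp add: P_def finite_simple_graph_def)
  qed
  have "edges G = {e \<in> edges G. x \<notin> e} \<union> {{u, v} |u v. u \<in> ?A \<and> v \<in> {x}}" (is "_ = ?L \<union> ?R")
  proof
    show "edges G \<subseteq> ?L \<union> ?R"
    proof
      fix e assume e: "e \<in> edges G"
      obtain u v where uv: "u \<in> verts G" "v \<in> verts G" "u \<noteq> v" "e = {u, v}"
        using G e by (rule edgeE)
      then have "x \<in> e \<Longrightarrow> \<exists>y\<in>?A. e = {y, x}"
        by (metis DiffI insert_commute insert_iff singletonD)
      then show "e \<in> ?L \<union> ?R" using e by blast
    qed
    have "{u, x} \<in> edges G" if "u \<in> ?A" for u
      using x that insert_commute[of u x "{}"] by (simp add: dominating_def)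
    then show "?L \<union> ?R \<subseteq> edges G" by blast
  qed
  then have "H \<otimes>\<^sub>g P = G"
    using x by (auto simp: join_def H_def P_def dominating_def prod_eq_iff insert_absorb)
  moreover have "antimagic (H \<otimes>\<^sub>g P)"
  proof -
    obtain f0 where f0: "bij_betw f0 (edges H \<union> edges P) {1..card (edges H \<union> edges P)}"
      using ex_inner_labelling[OF H P] by blast
    have fin: "finite ?A" using G by (simp add: finite_simple_graph_def)
    have "2 \<le> card ?A" using n x by (simp add: dominating_def card_Diff_singleton)
    moreover have "vertex_sum H f0 u \<le> (card ?A - 1) * card (edges H \<union> edges P)" if u: "u \<in> ?A" for u
    proof -
      have "vertex_sum H f0 u \<le> card (?A - {u}) * card (edges H \<union> edges P)"
        using fin edge_endpoints(2,3)[OF H, of u] bij_betwE[OF f0]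
        by (intro vertex_sum_le) (auto simp: H_def)
      then show ?thesis using u fin by (simp add: card_Diff_singleton)
    qed
    moreover have "vertex_sum P f0 x = 0" by (simp add: P_def vertex_sum_def)
    ultimately obtain c where
      "separating ?A {x} (vertex_sum H f0) (vertex_sum P f0) (card (edges H \<union> edges P)) c"
      using ex_separating_star[OF fin] by metis
    then show ?thesis
      by (intro antimagic_join_if_separating[OF H P _ f0]) (auto simp: H_def P_def)
  qed
  ultimately show ?thesis by simp
qed

text \<open>The absence of a dominating vertex supplies the bounds for \<open>ex_separating_pair\<close>: the two vertices
  of \<open>G2\<close> have no inner edge, and a vertex of \<open>G1\<close> has at most \<open>card (verts G1) - 2\<close> inner
  edges.\<close>

lemma antimagic_join_pair:
  fixes G1 G2 :: "'a graph"
  assumes G1: "finite_simple_graph G1" and G2: "finite_simple_graph G2"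
    and disj: "verts G1 \<inter> verts G2 = {}"
    and a: "2 \<le> card (verts G1)" and b: "card (verts G2) = 2"
    and not_dom: "\<nexists>x. dominating (G1 \<otimes>\<^sub>g G2) x"
  shows "antimagic (G1 \<otimes>\<^sub>g G2)"
proof -
  let ?A = "verts G1" and ?E0 = "edges G1 \<union> edges G2"
  obtain w w' where B: "verts G2 = {w, w'}" and w: "w \<noteq> w'"
    using b by (auto simp: card_2_iff)
  have fin: "finite ?A" using G1 by (simp add: finite_simple_graph_def)
  have cross: "{x, y} \<in> edges (G1 \<otimes>\<^sub>g G2)" "{y, x} \<in> edges (G1 \<otimes>\<^sub>g G2)"
    if "x \<in> ?A" "y \<in> verts G2" for x y
    using that by (auto simp: join_def insert_commute)
  have "{w, w'} \<notin> edges G2"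
  proof
    assume "{w, w'} \<in> edges G2"
    then have "dominating (G1 \<otimes>\<^sub>g G2) w"
      unfolding dominating_def using cross B by (auto simp: join_def)
    then show False using not_dom by blast
  qed
  have E2: "edges G2 = {}"
  proof (intro equals0I)
    fix e assume "e \<in> edges G2"
    then show False
      using edgeE[OF G2, of e] B \<open>{w, w'} \<notin> edges G2\<close> insert_commute[of w w' "{}"]
      by (metis insert_iff singletonD)
  qed
  have non_nbr: "\<exists>v\<in>?A. v \<noteq> u \<and> {u, v} \<notin> edges G1" if u: "u \<in> ?A" for u
  proof -
    have "\<not> dominating (G1 \<otimes>\<^sub>g G2) u" using not_dom by blast
    then show ?thesis
      unfolding dominating_def using u cross[OF u] by (auto simp: join_def)
  qed
  obtain f0 where f0: "bij_betw f0 ?E0 {1..card ?E0}"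
    using ex_inner_labelling[OF G1 G2] by blast
  have "vertex_sum G1 f0 u \<le> (card ?A - 2) * card ?E0" if u: "u \<in> ?A" for u
  proof -
    obtain v where v: "v \<in> ?A" "v \<noteq> u" "{u, v} \<notin> edges G1" using non_nbr[OF u] by blast
    have "vertex_sum G1 f0 u \<le> card (?A - {u, v}) * card ?E0"
      using fin v edge_endpoints(2,3)[OF G1, of u] bij_betwE[OF f0]
      by (intro vertex_sum_le) auto
    moreover have "card (?A - {u, v}) = card ?A - 2"
      using u v by (subst card_Diff_subset) auto
    ultimately show ?thesis by simp
  qed
  \<comment> \<open>On three vertices, two edges would meet in a vertex of degree 2, which would be dominating.\<close>
  moreover have "card ?E0 \<le> 1" if a3: "card ?A = 3"
  proof -
    have "e = e'" if e: "e \<in> edges G1" "e' \<in> edges G1" for e e'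
    proof -
      obtain u v where uv: "e = {u, v}" "u \<in> ?A" "v \<in> ?A" "u \<noteq> v"
        using G1 e(1) by (rule edgeE)
      obtain x y where xy: "e' = {x, y}" "x \<in> ?A" "y \<in> ?A" "x \<noteq> y"
        using G1 e(2) by (rule edgeE)
      have "card (?A - {u, v}) = 1"
        using a3 uv by (subst card_Diff_subset) auto
      then obtain z where "?A - {u, v} = {z}" by (rule card_1_singletonE)
      then have A: "?A = {u, v, z}" using uv by auto
      have "{u, z} \<notin> edges G1" "{v, z} \<notin> edges G1"
        using non_nbr[OF uv(2)] non_nbr[OF uv(3)] e(1) uv unfolding A by (auto simp: insert_commute)
      then show ?thesis using e(2) uv xy unfolding A by (auto simp: insert_commute)
    qed
    then show ?thesis
      using finite_edges[OF G1] E2 by (simp add: card_le_Suc0_iff_eq)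
  qed
  moreover have "vertex_sum G2 f0 w = 0" "vertex_sum G2 f0 w' = 0"
    using E2 by (simp_all add: vertex_sum_def)
  ultimately obtain c where
    "separating ?A {w, w'} (vertex_sum G1 f0) (vertex_sum G2 f0) (card ?E0) c"
    using ex_separating_pair[OF fin a _ _ w] by metis
  then show ?thesis
    using B by (intro antimagic_join_if_separating[OF G1 G2 disj f0]) simp
qed

theorem theorem2p1:
  fixes G :: "'a graph"
  assumes "finite_simple_graph G"
    and "card (verts G) \<ge> 3"
    and "join_graph G"
  shows "antimagic G"
proof (cases "\<exists>x. dominating G x")
  case True
  then obtain x where "dominating G x" ..
  then show ?thesis by (rule antimagic_if_dominating[OF assms(1,2)])
next
  case False
  obtain G1 G2 where G1: "finite_simple_graph G1" and G2: "finite_simple_graph G2"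
    and ne: "verts G1 \<noteq> {}" "verts G2 \<noteq> {}" and disj: "verts G1 \<inter> verts G2 = {}"
    and G: "G = G1 \<otimes>\<^sub>g G2"
    using assms(3) unfolding join_graph_def by metis
  have G': "G = G2 \<otimes>\<^sub>g G1" unfolding G by (rule join_commute)
  have two: "2 \<le> card (verts H1)"
    if "finite_simple_graph H1" "verts H1 \<noteq> {}" "G = H1 \<otimes>\<^sub>g H2" for H1 H2
  proof (rule ccontr)
    assume "\<not> 2 \<le> card (verts H1)"
    moreover have "card (verts H1) \<noteq> 0" using that by (simp add: finite_simple_graph_def)
    ultimately have "card (verts H1) = 1" by linarith
    then obtain x where "verts H1 = {x}" by (rule card_1_singletonE)
    then have "dominating G x" using that(3) by (simp add: dominating_def join_def) metis
    then show False using False by blast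
  qed
  have a: "2 \<le> card (verts G1)" using two[OF G1 ne(1) G] .
  have b: "2 \<le> card (verts G2)" using two[OF G2 ne(2) G'] .
  consider "card (verts G2) = 2" | "card (verts G1) = 2" | "3 \<le> card (verts G1)" "3 \<le> card (verts G2)"
    using a b by linarith
  then show ?thesis
  proof cases
    case 1
    then show ?thesis
      using antimagic_join_pair[OF G1 G2 disj a] False unfolding G[symmetric] by metis
  next
    case 2
    have "verts G2 \<inter> verts G1 = {}" using disj by blast
    then show ?thesis
      using antimagic_join_pair[OF G2 G1 _ b 2] False unfolding G'[symmetric] by metis
  next
    case 3
    obtain f0 where f0: "bij_betw f0 (edges G1 \<union> edges G2) {1..card (edges G1 \<union> edges G2)}"
      using ex_inner_labelling[OF G1 G2] by blast
    have "finite (verts G1)" "finite (verts G2)"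
      using G1 G2 by (auto simp: finite_simple_graph_def)
    then obtain c where "separating (verts G1) (verts G2) (vertex_sum G1 f0) (vertex_sum G2 f0)
        (card (edges G1 \<union> edges G2)) c"
      using ex_separating_greedy[OF _ _ a b disjI1 disjI1] 3 by blast
    then show ?thesis
      unfolding G by (rule antimagic_join_if_separating[OF G1 G2 disj f0])
  qed
qed

end
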